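(* Let $d\ge1$. If $U_1,U_2\subseteq\mathbb{Z}^d$ are co-connected and boundary disjoint sets, then exactly one of the following alternatives holds: (1) $U_1\cap U_2=\emptyset$; (2) $U_1^c\cap U_2^c=\emptyset$; (3) $U_1\subsetneq U_2$ or $U_2\subsetneq U_1$.
   Context: $\mathbb{Z}^d$ is regarded as the nearest-neighbor graph of the integer lattice; complements are taken in $\mathbb{Z}^d$. A set $U\subseteq\mathbb{Z}^d$ is co-connected if $U\ne\emptyset$, $U\ne\mathbb{Z}^d$, and both $U$ and $U^c$ are connected (induced subgraphs). The boundary $\partial U$ is the set of edges having one endpoint in $U$ and one endpoint in $U^c$. Two sets $U_1,U_2\subseteq\mathbb{Z}^d$ are boundary disjoint if (i) $\partial U_1\cap\partial U_2=\emptyset$, and (ii) there is no $4$-cycle in $\mathbb{Z}^d$ with vertices, in cyclic order, $(v_{00},v_{01},v_{11},v_{10})$ such that $v_{00}\in U_1^c\cap U_2^c$, $v_{01}\in U_1^c\cap U_2$, $v_{11}\in U_1\cap U_2$ and $v_{10}\in U_1\cap U_2^c$. *)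

theory Defs
  imports "HOL-Analysis.Finite_Cartesian_Product"
begin

definition lattice_adj :: "int ^ 'd::finite \<Rightarrow> int ^ 'd \<Rightarrow> bool" where
  "lattice_adj x y \<longleftrightarrow> (\<Sum>i\<in>UNIV. \<bar>x $ i - y $ i\<bar>) = 1"

definition lattice_edges :: "(int ^ 'd::finite) set set" where
  "lattice_edges = {{x, y} | x y. lattice_adj x y}"

text \<open>Connectedness of the subgraph induced on \<open>A\<close>: any two vertices of \<open>A\<close> are joined by a
  nearest-neighbor path all of whose vertices lie in \<open>A\<close>. The empty set counts as connected here.\<close>

definition lattice_connected :: "(int ^ 'd::finite) set \<Rightarrow> bool" where
  "lattice_connected A \<longleftrightarrow>
     (\<forall>x\<in>A. \<forall>y\<in>A. (\<lambda>u v. u \<in> A \<and> v \<in> A \<and> lattice_adj u v)\<^sup>*\<^sup>* x y)"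

definition co_connected :: "(int ^ 'd::finite) set \<Rightarrow> bool" where
  "co_connected U \<longleftrightarrow>
     U \<noteq> {} \<and> U \<noteq> UNIV \<and> lattice_connected U \<and> lattice_connected (- U)"

definition edge_boundary :: "(int ^ 'd::finite) set \<Rightarrow> (int ^ 'd) set set" where
  "edge_boundary U = {e \<in> lattice_edges. \<exists>x y. e = {x, y} \<and> x \<in> U \<and> y \<in> - U}"

definition lattice_4_cycle ::
  "int ^ 'd::finite \<Rightarrow> int ^ 'd \<Rightarrow> int ^ 'd \<Rightarrow> int ^ 'd \<Rightarrow> bool" where
  "lattice_4_cycle a b c d \<longleftrightarrow> distinct [a, b, c, d] \<and>
     lattice_adj a b \<and> lattice_adj b c \<and> lattice_adj c d \<and> lattice_adj d a"

definition boundary_disjoint :: "(int ^ 'd::finite) set \<Rightarrow> (int ^ 'd) set \<Rightarrow> bool" where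
  "boundary_disjoint U1 U2 \<longleftrightarrow>
     edge_boundary U1 \<inter> edge_boundary U2 = {} \<and>
     \<not> (\<exists>v00 v01 v11 v10. lattice_4_cycle v00 v01 v11 v10 \<and>
          v00 \<in> - U1 \<inter> - U2 \<and> v01 \<in> - U1 \<inter> U2 \<and> v11 \<in> U1 \<inter> U2 \<and> v10 \<in> U1 \<inter> - U2)"

end

theory Submission
  imports Defs
begin

text \<open>
  Label each vertex by its cell, with the cells \<open>- U1 \<inter> - U2\<close>, \<open>- U1 \<inter> U2\<close>,
  \<open>U1 \<inter> U2\<close>, \<open>U1 \<inter> - U2\<close> numbered \<open>0, 1, 2, 3\<close> modulo \<open>4\<close>. Boundary
  disjointness says that neighbouring labels differ by at most one modulo \<open>4\<close> and that no lattice
  square winds around \<open>\<int>/4\<close>. Hence the increments form a closed 1-form on \<open>\<int>\<^sup>d\<close>, which is exact, and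
  the labels lift to an integer height function with increments in \<open>{-1, 0, 1}\<close>. Each of \<open>U1\<close>, \<open>U2\<close>
  and their complements consists of two cyclically adjacent labels, so by connectedness the height takes
  only two consecutive values on it. If all four cells were nonempty, going once around them would
  raise the height by \<open>4\<close>, a contradiction.
\<close>

section \<open>Exactness of closed 1-forms on the integer lattice\<close>

lemma antidifference_exists:
  fixes f :: "int \<Rightarrow> 'b::ab_group_add"
  shows "\<exists>P. \<forall>t. P (t + 1) - P t = f t"
proof -
  \<comment> \<open>An oriented sum from \<open>0\<close> to \<open>n\<close>: one of the two
    intervals is always empty.\<close>
  define P where "P n = sum f {0..<n} - sum f {n..<0}" for n :: int
  have "P (t + 1) - P t = f t" for t
  proof (cases "0 \<le> t")
    case True
    then have "{0..<t + 1} = insert t {0..<t}" by auto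
    with True show ?thesis by (simp add: P_def)
  next
    case False
    then have "{t..<0} = insert t {t + 1..<0}" by auto
    with False show ?thesis by (simp add: P_def)
  qed
  then show ?thesis by blast
qed

text \<open>A primitive for the directions in \<open>S\<close> is corrected in one new direction
  \<open>j\<close>. Closedness makes its defect in direction \<open>j\<close> invariant under the
  directions in \<open>S\<close>, so summing the defect along \<open>j\<close> does not spoil what
  was achieved.\<close>

lemma closed_form_exact_on:
  fixes w :: "'d::finite \<Rightarrow> int ^ 'd \<Rightarrow> 'b::ab_group_add"
  assumes closed: "\<And>i j x. w j (x + axis i 1) - w j x = w i (x + axis j 1) - w i x"
    and "finite S"
  shows "\<exists>h. \<forall>i\<in>S. \<forall>x. h (x + axis i 1) - h x = w i x"
  using \<open>finite S\<close>
proof (induction S rule: finite_induct)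
  case empty
  then show ?case by simp
next
  case (insert j S)
  then obtain h where h: "\<And>i x. i \<in> S \<Longrightarrow> h (x + axis i 1) - h x = w i x" by blast
  define g where "g x = w j x - (h (x + axis j 1) - h x)" for x
  have g_inv: "g (x + axis i 1) = g x" if "i \<in> S" for i x
  proof -
    have "x + axis i 1 + axis j 1 = x + axis j 1 + axis i 1"
      by (simp add: algebra_simps)
    then show ?thesis
      using h[OF that, of x] h[OF that, of "x + axis j 1"] closed[of j x i]
      by (simp add: g_def algebra_simps)
  qed
  obtain P :: "(int \<Rightarrow> 'b) \<Rightarrow> int \<Rightarrow> 'b" where P: "\<And>f t. P f (t + 1) - P f t = f t"
    using antidifference_exists by metis
  \<comment> \<open>The defect \<open>g\<close> is summed along the line in direction \<open>j\<close>. Choosing the antidifference by a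
    function \<open>P\<close> of the restriction of \<open>g\<close> to that line makes \<open>G\<close> invariant in the directions of \<open>S\<close>.\<close>
  define ins where "ins x t = (\<chi> k. if k = j then t else x $ k)" for x :: "int ^ 'd" and t
  define line where "line x t = g (ins x t)" for x t
  define G where "G x = P (line x) (x $ j)" for x
  have "G (x + axis i 1) = G x" if "i \<in> S" for i x
  proof -
    have "i \<noteq> j" using that insert.hyps by blast
    then have "ins (x + axis i 1) t = ins x t + axis i 1" for t
      by (auto simp: vec_eq_iff ins_def axis_def)
    then have "line (x + axis i 1) = line x"
      by (auto simp: line_def g_inv[OF that])
    with \<open>i \<noteq> j\<close> show ?thesis by (simp add: G_def axis_def)
  qed
  moreover have "G (x + axis j 1) - G x = g x" for x
  proof -
    have "line (x + axis j 1) = line x"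
      by (auto simp: line_def ins_def vec_eq_iff axis_def intro!: ext arg_cong[of _ _ g])
    moreover have "ins x (x $ j) = x" by (simp add: ins_def vec_eq_iff)
    ultimately show ?thesis by (simp add: G_def P) (simp add: line_def)
  qed
  ultimately have "h (x + axis i 1) + G (x + axis i 1) - (h x + G x) = w i x"
    if "i \<in> insert j S" for i x
    using that h[of i x]
    by (smt (verit) add_diff_add add.right_neutral diff_add_cancel diff_self g_def insert_iff
        add.commute)
  then show ?case by (intro exI[of _ "\<lambda>x. h x + G x"]) blast
qed

section \<open>Adjacency, connectedness and boundaries in the lattice\<close>

lemma lattice_adj_axis: "lattice_adj x (x + axis i 1)"
  by (simp add: lattice_adj_def axis_def if_distrib cong: if_cong)

lemma lattice_adj_commute: "lattice_adj x y \<longleftrightarrow> lattice_adj y x"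
  by (simp add: lattice_adj_def abs_minus_commute)

lemma lattice_adjE:
  assumes "lattice_adj x y"
  obtains i where "y = x + axis i 1 \<or> x = y + axis i 1"
proof -
  have sum: "(\<Sum>i\<in>UNIV. \<bar>x $ i - y $ i\<bar>) = 1"
    using assms by (simp add: lattice_adj_def)
  then obtain i where i: "x $ i \<noteq> y $ i" by force
  have split: "\<bar>x $ i - y $ i\<bar> + (\<Sum>k\<in>UNIV - {i}. \<bar>x $ k - y $ k\<bar>) = 1"
    using sum by (simp add: sum.remove[of UNIV i])
  moreover have "0 \<le> (\<Sum>k\<in>UNIV - {i}. \<bar>x $ k - y $ k\<bar>)"
    by (simp add: sum_nonneg)
  ultimately have one: "\<bar>x $ i - y $ i\<bar> = 1"
    and zero: "(\<Sum>k\<in>UNIV - {i}. \<bar>x $ k - y $ k\<bar>) = 0"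
    using i by linarith+
  have rest: "x $ k = y $ k" if "k \<noteq> i" for k
    using zero that by (simp add: sum_nonneg_eq_0_iff)
  show ?thesis
  proof (rule that[of i], cases "y $ i = x $ i + 1")
    case True
    then show "y = x + axis i 1 \<or> x = y + axis i 1"
      using rest by (auto simp: vec_eq_iff axis_def)
  next
    case False
    then have "x $ i = y $ i + 1" using one by linarith
    then show "y = x + axis i 1 \<or> x = y + axis i 1"
      using rest by (auto simp: vec_eq_iff axis_def)
  qed
qed

lemma translation_invariant_imp_constant:
  fixes F :: "int ^ 'd::finite \<Rightarrow> 'b"
  assumes inv: "\<And>x i. F (x + axis i 1) = F x"
  shows "F x = F y"
proof -
  have step: "F (x + axis i t) = F x" for x i t
  proof (induction t rule: int_induct[where k = 0])
    case base
    then show ?case by (simp add: axis_def vec_eq_iff zero_vec_def[symmetric])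
  next
    case (step1 t)
    have "x + axis i (t + 1) = (x + axis i t) + axis i 1"
      by (auto simp: vec_eq_iff axis_def)
    then show ?case using step1 inv by metis
  next
    case (step2 t)
    have "x + axis i t = (x + axis i (t - 1)) + axis i 1"
      by (auto simp: vec_eq_iff axis_def)
    then show ?case using step2 inv by metis
  qed
  have "F (x + (\<Sum>i\<in>S. axis i (y $ i - x $ i))) = F x" if "finite S" for S
    using that
  proof induction
    case (insert i S)
    then show ?case
      using step[of "x + (\<Sum>i\<in>S. axis i (y $ i - x $ i))" i "y $ i - x $ i"]
      by (simp add: algebra_simps)
  qed simp
  moreover have "x + (\<Sum>i\<in>UNIV. axis i (y $ i - x $ i)) = y"
    by (simp add: vec_eq_iff axis_def)
  ultimately show ?thesis by (metis finite)
qed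

lemma lattice_connected_imp_constant:
  assumes "lattice_connected A" "x \<in> A" "y \<in> A"
    and "\<And>u v. u \<in> A \<Longrightarrow> v \<in> A \<Longrightarrow> lattice_adj u v \<Longrightarrow> F u = F v"
  shows "F x = F y"
proof -
  have "(\<lambda>u v. u \<in> A \<and> v \<in> A \<and> lattice_adj u v)\<^sup>*\<^sup>* x y"
    using assms(1-3) by (auto simp: lattice_connected_def)
  then show ?thesis
    by induction (use assms(4) in auto)
qed

lemma edge_boundary_Compl: "edge_boundary (- U) = edge_boundary U"
  by (auto simp: edge_boundary_def insert_commute)

lemma edge_boundary_insert_iff:
  assumes "lattice_adj x y"
  shows "{x, y} \<in> edge_boundary U \<longleftrightarrow> (x \<in> U \<longleftrightarrow> y \<notin> U)"
  using assms by (auto simp: edge_boundary_def lattice_edges_def doubleton_eq_iff)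

text \<open>With an empty boundary, membership in \<open>U\<close> would be invariant under all unit
  translations.\<close>

lemma edge_boundary_nonempty:
  assumes "U \<noteq> {}" "U \<noteq> UNIV"
  shows "edge_boundary U \<noteq> {}"
proof
  assume "edge_boundary U = {}"
  then have "(x + axis i 1 \<in> U) = (x \<in> U)" for x i
    using edge_boundary_insert_iff[OF lattice_adj_axis[of x i], of U] by auto
  then have "(x \<in> U) = (y \<in> U)" for x y
    by (rule translation_invariant_imp_constant[where F = "\<lambda>x. x \<in> U"])
  with assms show False by blast
qed

lemma lattice_4_cycle_axis:
  assumes "i \<noteq> j"
  shows "lattice_4_cycle x (x + axis i 1) (x + axis i 1 + axis j 1) (x + axis j 1)"
proof -
  have "lattice_adj (x + axis i 1 + axis j 1) (x + axis j 1)"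
    by (metis lattice_adj_axis lattice_adj_commute add.assoc add.commute)
  moreover have "lattice_adj (x + axis j 1) x"
    using lattice_adj_axis lattice_adj_commute by blast
  moreover have "axis i 1 \<noteq> (axis j 1 :: int ^ 'a)" "axis i 1 + axis j 1 \<noteq> (0 :: int ^ 'a)"
    "axis k 1 \<noteq> (0 :: int ^ 'a)" for k
    using assms by (auto simp: vec_eq_iff axis_def)
  ultimately show ?thesis
    by (simp add: lattice_4_cycle_def lattice_adj_axis)
qed

lemma lattice_4_cycle_rotate: "lattice_4_cycle a b c d \<Longrightarrow> lattice_4_cycle b c d a"
  by (auto simp: lattice_4_cycle_def)

lemma lattice_4_cycle_reverse: "lattice_4_cycle a b c d \<Longrightarrow> lattice_4_cycle d c b a"
  by (auto simp: lattice_4_cycle_def lattice_adj_commute)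

section \<open>Cell labels and closedness of their increments\<close>

definition cell_label :: "'a set \<Rightarrow> 'a set \<Rightarrow> 'a \<Rightarrow> int" where
  "cell_label U1 U2 x = (if x \<in> U1 then if x \<in> U2 then 2 else 3 else if x \<in> U2 then 1 else 0)"

text \<open>The label difference modulo \<open>4\<close>, represented in \<open>{-1, 0, 1, 2}\<close>; the value \<open>2\<close> means that the
  step crosses both boundaries.\<close>

definition label_step :: "'a set \<Rightarrow> 'a set \<Rightarrow> 'a \<Rightarrow> 'a \<Rightarrow> int" where
  "label_step U1 U2 x y = (cell_label U1 U2 y - cell_label U1 U2 x + 1) mod 4 - 1"

context
  fixes U1 U2 :: "(int ^ 'd::finite) set"
  assumes disjoint: "boundary_disjoint U1 U2"
begin

lemma not_both_boundaries:
  assumes "lattice_adj x y"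
  shows "(x \<in> U1 \<longleftrightarrow> y \<in> U1) \<or> (x \<in> U2 \<longleftrightarrow> y \<in> U2)"
  using disjoint edge_boundary_insert_iff[OF assms, of U1] edge_boundary_insert_iff[OF assms, of U2]
  by (auto simp: boundary_disjoint_def)

lemma label_step_bounds:
  "lattice_adj x y \<Longrightarrow> -1 \<le> label_step U1 U2 x y \<and> label_step U1 U2 x y \<le> 1"
  using not_both_boundaries[of x y] by (auto simp: label_step_def cell_label_def)

text \<open>Adjacency matters: a step of value \<open>2\<close> would have value \<open>2\<close> in
  both directions.\<close>

lemma label_step_antisym:
  "lattice_adj x y \<Longrightarrow> label_step U1 U2 y x = - label_step U1 U2 x y"
  using not_both_boundaries[of x y] by (auto simp: label_step_def cell_label_def)

lemma not_winding:
  assumes "lattice_4_cycle a b c d"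
  shows "\<not> (a \<notin> U1 \<and> a \<notin> U2 \<and> b \<notin> U1 \<and> b \<in> U2 \<and> c \<in> U1 \<and> c \<in> U2 \<and> d \<in> U1 \<and> d \<notin> U2)"
  using disjoint assms unfolding boundary_disjoint_def by blast

lemma label_step_eq_1D:
  assumes "label_step U1 U2 x y = 1"
  shows "cell_label U1 U2 y = (cell_label U1 U2 x + 1) mod 4"
  using assms by (auto simp: label_step_def cell_label_def split: if_splits)

text \<open>Three steps of \<open>1\<close> make the square run through all four labels in cyclic
  order. Rotated to start at label \<open>0\<close>, it is the forbidden 4-cycle.\<close>

lemma not_all_label_steps_1:
  assumes cycle: "lattice_4_cycle a b c d"
    and step: "label_step U1 U2 a b = 1" "label_step U1 U2 b c = 1" "label_step U1 U2 c d = 1"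
  shows False
proof -
  let ?l = "cell_label U1 U2"
  note rotations = cycle lattice_4_cycle_rotate[OF cycle]
    lattice_4_cycle_rotate[OF lattice_4_cycle_rotate[OF cycle]]
    lattice_4_cycle_rotate[OF lattice_4_cycle_rotate[OF lattice_4_cycle_rotate[OF cycle]]]
  note no_winding = rotations[THEN not_winding]
  have mem: "?l x = 0 \<longleftrightarrow> x \<notin> U1 \<and> x \<notin> U2" "?l x = 1 \<longleftrightarrow> x \<notin> U1 \<and> x \<in> U2"
    "?l x = 2 \<longleftrightarrow> x \<in> U1 \<and> x \<in> U2" "?l x = 3 \<longleftrightarrow> x \<in> U1 \<and> x \<notin> U2" for x
    by (auto simp: cell_label_def)
  have labels: "?l b = (?l a + 1) mod 4" "?l c = (?l b + 1) mod 4" "?l d = (?l c + 1) mod 4"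
    using step by (auto dest: label_step_eq_1D)
  have "?l a = 0 \<or> ?l a = 1 \<or> ?l a = 2 \<or> ?l a = 3"
    by (simp add: cell_label_def)
  then show False
  proof (elim disjE)
    assume "?l a = 0"
    with labels have "?l b = 1" "?l c = 2" "?l d = 3" by simp_all
    with \<open>?l a = 0\<close> no_winding(1) show False unfolding mem by blast
  next
    assume "?l a = 1"
    with labels have "?l b = 2" "?l c = 3" "?l d = 0" by simp_all
    with \<open>?l a = 1\<close> no_winding(4) show False unfolding mem by blast
  next
    assume "?l a = 2"
    with labels have "?l b = 3" "?l c = 0" "?l d = 1" by simp_all
    with \<open>?l a = 2\<close> no_winding(3) show False unfolding mem by blast
  next
    assume "?l a = 3"
    with labels have "?l b = 0" "?l c = 1" "?l d = 2" by simp_all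
    with \<open>?l a = 3\<close> no_winding(2) show False unfolding mem by blast
  qed
qed

text \<open>For squares along two axes this is the closedness required by
  \<open>closed_form_exact_on\<close>.\<close>

lemma label_step_square:
  assumes cycle: "lattice_4_cycle a b c d"
  shows "label_step U1 U2 a b + label_step U1 U2 b c = label_step U1 U2 a d + label_step U1 U2 d c"
proof (rule ccontr)
  let ?s = "label_step U1 U2" and ?l = "cell_label U1 U2"
  assume neq: "?s a b + ?s b c \<noteq> ?s a d + ?s d c"
  have adj: "lattice_adj a b" "lattice_adj b c" "lattice_adj c d" "lattice_adj d a"
    using cycle by (auto simp: lattice_4_cycle_def)
  note bounds = adj[THEN label_step_bounds]
  have antisym: "?s d c = - ?s c d" "?s a d = - ?s d a" "?s b a = - ?s a b" "?s c b = - ?s b c"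
    using adj by (simp_all add: label_step_antisym)
  have multiple: "\<exists>q. ?s x y = ?l y - ?l x - 4 * q" for x y
    by (rule exI[of _ "(?l y - ?l x + 1) div 4"])
      (simp add: label_step_def minus_mult_div_eq_mod[symmetric])
  \<comment> \<open>The total step around the square is a multiple of \<open>4\<close> of modulus at most \<open>4\<close>, so if it is
    nonzero, then all four steps are equal to \<open>1\<close> or all to \<open>-1\<close>.\<close>
  obtain q1 q2 q3 q4 where "?s a b = ?l b - ?l a - 4 * q1" "?s b c = ?l c - ?l b - 4 * q2"
    "?s c d = ?l d - ?l c - 4 * q3" "?s d a = ?l a - ?l d - 4 * q4"
    using multiple by metis
  then obtain q where sum: "?s a b + ?s b c + ?s c d + ?s d a = 4 * q"
    using that[of "- q1 - q2 - q3 - q4"] by simp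
  with neq antisym have "q \<noteq> 0" by auto
  then consider "1 \<le> q" | "q \<le> -1" by linarith
  then show False
  proof cases
    case 1
    then have "?s a b = 1" "?s b c = 1" "?s c d = 1"
      using sum bounds by linarith+
    then show False by (rule not_all_label_steps_1[OF cycle])
  next
    case 2
    \<comment> \<open>Traversing the square backwards turns steps of \<open>-1\<close> into steps of
      \<open>1\<close>.\<close>
    then have "?s d c = 1" "?s c b = 1" "?s b a = 1"
      using sum bounds antisym by linarith+
    then show False by (rule not_all_label_steps_1[OF lattice_4_cycle_reverse[OF cycle]])
  qed
qed

section \<open>Lifting the labels to integer heights\<close>

lemma height_function_exists:
  obtains H :: "int ^ 'd \<Rightarrow> int"
  where "\<And>x. H x mod 4 = cell_label U1 U2 x"
    and "\<And>x y. lattice_adj x y \<Longrightarrow> \<bar>H x - H y\<bar> \<le> 1"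
proof -
  let ?l = "cell_label U1 U2"
  let ?w = "\<lambda>i x. label_step U1 U2 x (x + axis i 1)"
  have closed: "?w j (x + axis i 1) - ?w j x = ?w i (x + axis j 1) - ?w i x" for i j x
  proof (cases "i = j")
    case False
    have "x + axis j 1 + axis i 1 = x + axis i 1 + axis j 1"
      by (simp add: algebra_simps)
    then show ?thesis
      using label_step_square[OF lattice_4_cycle_axis[OF False, of x]]
      by (simp add: algebra_simps)
  qed simp
  obtain h where h: "\<And>i x. h (x + axis i 1) - h x = ?w i x"
    using closed_form_exact_on[of ?w UNIV, OF closed] by auto
  have "(h (x + axis i 1) - ?l (x + axis i 1)) mod 4 = (h x - ?l x) mod 4" for x i
  proof -
    let ?m = "?l (x + axis i 1) - ?l x + 1"
    have "h (x + axis i 1) - ?l (x + axis i 1) = (h x - ?l x) + (?m mod 4 - ?m)"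
      using h[of x i] by (simp add: label_step_def)
    then have "h (x + axis i 1) - ?l (x + axis i 1) = (h x - ?l x) + 4 * (- (?m div 4))"
      by (simp add: minus_mult_div_eq_mod[symmetric])
    then show ?thesis by (metis mod_mult_self2)
  qed
  then have const: "(h x - ?l x) mod 4 = (h 0 - ?l 0) mod 4" for x
    by (rule translation_invariant_imp_constant[where F = "\<lambda>x. (h x - ?l x) mod 4"])
  \<comment> \<open>The lift is \<open>h\<close> shifted by the constant \<open>h 0 - ?l 0\<close>,
    which makes it agree with the label at the origin and hence modulo \<open>4\<close>
    everywhere.\<close>
  show thesis
  proof
    fix x
    have "(h x - (h 0 - ?l 0)) mod 4 = ?l x mod 4"
      using const[of x] by (simp add: mod_eq_dvd_iff algebra_simps)
    then show "(h x - (h 0 - ?l 0)) mod 4 = ?l x"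
      by (simp add: cell_label_def split: if_splits)
  next
    fix x y :: "int ^ 'd"
    assume "lattice_adj x y"
    then obtain i where "y = x + axis i 1 \<or> x = y + axis i 1" by (rule lattice_adjE)
    then show "\<bar>(h x - (h 0 - ?l 0)) - (h y - (h 0 - ?l 0))\<bar> \<le> 1"
      using h[of x i] h[of y i] label_step_bounds[OF lattice_adj_axis[of x i]]
        label_step_bounds[OF lattice_adj_axis[of y i]] by auto
  qed
qed

lemma some_cell_empty:
  assumes "co_connected U1" "co_connected U2"
  shows "U1 \<inter> U2 = {} \<or> - U1 \<inter> - U2 = {} \<or> U1 \<subseteq> U2 \<or> U2 \<subseteq> U1"
proof (rule ccontr)
  assume "\<not> ?thesis"
  then obtain a b c d where
    cells: "a \<notin> U1" "a \<notin> U2" "b \<notin> U1" "b \<in> U2" "c \<in> U1" "c \<in> U2" "d \<in> U1" "d \<notin> U2"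
    by blast
  obtain H :: "int ^ 'd \<Rightarrow> int" where H: "\<And>x. H x mod 4 = cell_label U1 U2 x"
    and H_step: "\<And>x y. lattice_adj x y \<Longrightarrow> \<bar>H x - H y\<bar> \<le> 1"
    using height_function_exists by blast
  \<comment> \<open>The shift \<open>k\<close> rotates the two labels occurring on \<open>A\<close>
    to the residues \<open>0\<close> and \<open>1\<close>. Passing to another block of four would
    then need a jump of at least \<open>3\<close>, so the quotient by \<open>4\<close> is constant
    on \<open>A\<close>.\<close>
  have close: "\<bar>H x - H y\<bar> \<le> 1"
    if "lattice_connected A" "x \<in> A" "y \<in> A" "\<And>z. z \<in> A \<Longrightarrow> (cell_label U1 U2 z + k) mod 4 \<le> 1"
    for A x y k
  proof -
    have low: "0 \<le> (H z + k) mod 4" "(H z + k) mod 4 \<le> 1" if "z \<in> A" for z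
      using \<open>\<And>z. z \<in> A \<Longrightarrow> _\<close>[OF that] by (simp_all add: mod_simps flip: H)
    have "(H x + k) div 4 = (H y + k) div 4"
    proof (rule lattice_connected_imp_constant[OF that(1-3)])
      fix u v
      assume "u \<in> A" "v \<in> A" "lattice_adj u v"
      then have "\<bar>H u - H v\<bar> \<le> 1" by (simp add: H_step)
      with low[OF \<open>u \<in> A\<close>] low[OF \<open>v \<in> A\<close>] show "(H u + k) div 4 = (H v + k) div 4"
        using mult_div_mod_eq[of 4 "H u + k"] mult_div_mod_eq[of 4 "H v + k"] by linarith
    qed
    then show ?thesis
      using low[OF that(2)] low[OF that(3)]
        mult_div_mod_eq[of 4 "H x + k"] mult_div_mod_eq[of 4 "H y + k"] by linarith
  qed
  have conn: "lattice_connected U1" "lattice_connected (- U1)"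
    "lattice_connected U2" "lattice_connected (- U2)"
    using assms by (auto simp: co_connected_def)
  have "\<bar>H a - H b\<bar> \<le> 1"
    by (rule close[OF conn(2), where k = 0]) (use cells in \<open>auto simp: cell_label_def\<close>)
  moreover have "\<bar>H b - H c\<bar> \<le> 1"
    by (rule close[OF conn(3), where k = 3]) (use cells in \<open>auto simp: cell_label_def\<close>)
  moreover have "\<bar>H c - H d\<bar> \<le> 1"
    by (rule close[OF conn(1), where k = 2]) (use cells in \<open>auto simp: cell_label_def\<close>)
  moreover have "\<bar>H d - H a\<bar> \<le> 1"
    by (rule close[OF conn(4), where k = 1]) (use cells in \<open>auto simp: cell_label_def\<close>)
  moreover have "H a mod 4 = 0" "H b mod 4 = 1" "H c mod 4 = 2" "H d mod 4 = 3"
    using cells by (auto simp: H cell_label_def)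
  moreover obtain p where p: "\<And>x. H x = 4 * p x + H x mod 4"
    using that[of "\<lambda>x. H x div 4"] by simp
  ultimately have heights: "\<bar>H a - H b\<bar> \<le> 1" "\<bar>H b - H c\<bar> \<le> 1"
    "\<bar>H c - H d\<bar> \<le> 1" "\<bar>H d - H a\<bar> \<le> 1"
    "H a = 4 * p a" "H b = 4 * p b + 1" "H c = 4 * p c + 2" "H d = 4 * p d + 3"
    using p[of a] p[of b] p[of c] p[of d] by auto
  \<comment> \<open>The first three bounds put all four heights in one block, where
    \<open>H d - H a = 3\<close> violates the fourth.\<close>
  then have "p a = p b" "p b = p c" "p c = p d" by linarith+
  with heights show False by linarith
qed

end

section \<open>Exactly one alternative\<close>

theorem theorem3p2:
  fixes U1 U2 :: "(int ^ 'd::finite) set"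
  assumes "co_connected U1" and "co_connected U2"
    and "boundary_disjoint U1 U2"
  shows "(U1 \<inter> U2 = {} \<and> - U1 \<inter> - U2 \<noteq> {} \<and> \<not> (U1 \<subset> U2 \<or> U2 \<subset> U1)) \<or>
         (U1 \<inter> U2 \<noteq> {} \<and> - U1 \<inter> - U2 = {} \<and> \<not> (U1 \<subset> U2 \<or> U2 \<subset> U1)) \<or>
         (U1 \<inter> U2 \<noteq> {} \<and> - U1 \<inter> - U2 \<noteq> {} \<and> (U1 \<subset> U2 \<or> U2 \<subset> U1))"
proof -
  have proper: "U1 \<noteq> {}" "U1 \<noteq> UNIV" "U2 \<noteq> {}" "U2 \<noteq> UNIV"
    using assms by (auto simp: co_connected_def)
  have "edge_boundary U1 \<inter> edge_boundary U2 = {}"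
    using assms by (simp add: boundary_disjoint_def)
  \<comment> \<open>Equal or complementary sets share their boundary, which is nonempty. The first
    inequality makes inclusions strict, the second separates the first two alternatives.\<close>
  then have neq: "U1 \<noteq> U2" "U1 \<noteq> - U2"
    using edge_boundary_nonempty[OF proper(3-4)] by (auto simp: edge_boundary_Compl)
  have "\<not> (U1 \<inter> U2 = {} \<and> - U1 \<inter> - U2 = {})" using neq(2) by blast
  moreover have "U1 \<inter> U2 = {} \<Longrightarrow> \<not> (U1 \<subset> U2 \<or> U2 \<subset> U1)"
    using proper(1,3) by blast
  moreover have "- U1 \<inter> - U2 = {} \<Longrightarrow> \<not> (U1 \<subset> U2 \<or> U2 \<subset> U1)"
    using proper(2,4) by blast
  moreover have "U1 \<inter> U2 = {} \<or> - U1 \<inter> - U2 = {} \<or> U1 \<subset> U2 \<or> U2 \<subset> U1"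
    using some_cell_empty[OF assms(3,1,2)] neq(1) by (metis psubsetI)
  ultimately show ?thesis by metis
qed

end
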